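(* Let $\boldsymbol{\omega}=\omega_0\omega_1\omega_2\ldots$ be the Fibonacci word, i.e. $\omega_i=2+\lfloor (i+1)\varphi\rfloor-\lfloor (i+2)\varphi\rfloor$ for $i\ge 0$, where $\varphi=(1+\sqrt5)/2$. Let $1<b<\infty$ and let $\delta>0$ be given by $$\delta=1-\frac1b+\frac1b\left(1-\frac1b\right)\sum_{k\ge 0}\omega_k b^{-k}.$$ Then the financial process with parameters $$v_1=1000,\quad v_2=500,\quad r=\frac1b-1,\quad \rho=\frac{500b}{b-1}\bigl[b(1-\delta)+1\bigr]$$ is chaotic.
   Context: The financial process with parameters $v_1,v_2\ge 0$, $r\in(-1,0)$, $\rho>0$ is the following: for each initial value $S_0\ge 0$, the financial time series $(S_n)_{n\ge 0}$ starting at $S_0$ is defined by $S_n=f(S_{n-1})$, $n\ge 1$, where $f:[0,\infty)\to[0,\infty)$ is given by $f(x)=(1+r)x+v_1$ if $x<\rho$ and $f(x)=(1+r)x+v_2$ if $x\ge\rho$. The $\omega$-limit set of a real sequence $(S_n)_{n\ge 0}$ is the set of all $p\in\mathbb{R}$ for which there exist $n_1<n_2<n_3<\cdots$ with $\lim_{k\to\infty}S_{n_k}=p$. A Cantor set is a (nonempty) compact, perfect, nowhere dense subset of $\mathbb{R}$. Sensitive dependence: the financial time series of the process have sensitive dependence on initial conditions at $S_0\ge 0$ if for some constant $\eta>0$ the following holds: for each $\epsilon>0$ there exist $S_0'\ge 0$ and $k\in\mathbb{N}$ such that $|S_0'-S_0|\le\epsilon$ and $|S_k'-S_k|\ge\eta$,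 where $(S_n')_{n\ge 0}$ and $(S_n)_{n\ge 0}$ are the time series of the process with starting points $S_0'$ and $S_0$, respectively. The financial process is chaotic if there exists a Cantor set $C\subset[0,\infty)$ such that: (C1) each financial time series of the process (for every $S_0\ge 0$) has $C$ as its $\omega$-limit set; (C2) the financial time series of the process have sensitive dependence on initial conditions at each $S_0\in C$; (C3) for each interval $J\subset[0,\infty)$ there exists a constant $c_J\ge 0$ such that $\lim_{N\to\infty}\frac1N\#\{0\le n\le N-1: S_n\in J\}=c_J$ for all financial time series $(S_n)_{n\ge 0}$ of the process (i.e. for all $S_0\ge 0$), where $\#$ denotes cardinality. *)

theory Defs
  imports "HOL-Analysis.Analysis"
begin

definition golden_ratio :: real where
  "golden_ratio = (1 + sqrt 5) / 2"

definition fibonacci_word :: "nat \<Rightarrow> int" where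
  "fibonacci_word i =
     2 + \<lfloor>(real i + 1) * golden_ratio\<rfloor> - \<lfloor>(real i + 2) * golden_ratio\<rfloor>"

definition omega_limit_set :: "(nat \<Rightarrow> real) \<Rightarrow> real set" where
  "omega_limit_set S = {p. \<exists>n :: nat \<Rightarrow> nat. strict_mono n \<and> (\<lambda>k. S (n k)) \<longlonglongrightarrow> p}"

text \<open>
  Perfect means closed without isolated points; closedness is part of compactness here.
\<close>

definition cantor_set :: "real set \<Rightarrow> bool" where
  "cantor_set C \<longleftrightarrow>
     C \<noteq> {} \<and> compact C \<and> (\<forall>x\<in>C. x islimpt C) \<and> interior (closure C) = {}"

text \<open>
  The state space of the process is the half-line of nonnegative reals. The map is defined on all
  reals, but every quantifier over starting points below ranges over nonnegative values only, and
  for admissible parameters the map sends the half-line into itself.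
\<close>

definition admissible_parameters :: "real \<Rightarrow> real \<Rightarrow> real \<Rightarrow> real \<Rightarrow> bool" where
  "admissible_parameters v1 v2 r \<rho> \<longleftrightarrow>
     v1 \<ge> 0 \<and> v2 \<ge> 0 \<and> r \<in> {-1<..<0} \<and> \<rho> > 0"

definition financial_map :: "real \<Rightarrow> real \<Rightarrow> real \<Rightarrow> real \<Rightarrow> real \<Rightarrow> real" where
  "financial_map v1 v2 r \<rho> x = (if x < \<rho> then (1 + r) * x + v1 else (1 + r) * x + v2)"

primrec financial_series ::
  "real \<Rightarrow> real \<Rightarrow> real \<Rightarrow> real \<Rightarrow> real \<Rightarrow> nat \<Rightarrow> real" where
  "financial_series v1 v2 r \<rho> S\<^sub>0 0 = S\<^sub>0"
| "financial_series v1 v2 r \<rho> S\<^sub>0 (Suc n) =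
     financial_map v1 v2 r \<rho> (financial_series v1 v2 r \<rho> S\<^sub>0 n)"

definition sensitive_dependence_at :: "real \<Rightarrow> real \<Rightarrow> real \<Rightarrow> real \<Rightarrow> real \<Rightarrow> bool" where
  "sensitive_dependence_at v1 v2 r \<rho> S\<^sub>0 \<longleftrightarrow>
     (\<exists>\<eta>>0. \<forall>\<epsilon>>0. \<exists>S\<^sub>0'\<ge>0. \<exists>k.
        \<bar>S\<^sub>0' - S\<^sub>0\<bar> \<le> \<epsilon> \<and>
        \<bar>financial_series v1 v2 r \<rho> S\<^sub>0' k - financial_series v1 v2 r \<rho> S\<^sub>0 k\<bar> \<ge> \<eta>)"

definition chaotic_financial_process :: "real \<Rightarrow> real \<Rightarrow> real \<Rightarrow> real \<Rightarrow> bool" where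
  "chaotic_financial_process v1 v2 r \<rho> \<longleftrightarrow>
     (\<exists>C. cantor_set C \<and> C \<subseteq> {0..} \<and>
        (\<forall>S\<^sub>0\<ge>0. omega_limit_set (financial_series v1 v2 r \<rho> S\<^sub>0) = C) \<and>
        (\<forall>S\<^sub>0\<in>C. sensitive_dependence_at v1 v2 r \<rho> S\<^sub>0) \<and>
        (\<forall>J. is_interval J \<and> J \<subseteq> {0..} \<longrightarrow>
           (\<exists>c\<ge>0. \<forall>S\<^sub>0\<ge>0.
              (\<lambda>N. 1 / real N * real (card {n. n < N \<and> financial_series v1 v2 r \<rho> S\<^sub>0 n \<in> J}))
                \<longlonglongrightarrow> c)))"

end

theory Submission
  imports Defs
begin

text \<open>
  In the coordinate y with S = A + 500y the process becomes the contracted rotation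
  y \<mapsto> qy + \<delta> (mod 1) with q = 1/b. The parameter \<delta> is chosen so that its rotation number is the
  irrational number \<alpha> = 2 - \<phi>, where \<phi> is the golden ratio: the Fibonacci word is the Sturmian word of
  slope \<alpha>, and its series is exactly the offset that this rotation number requires.

  The proof compares the process with the rotation t \<mapsto> t + \<alpha> of the circle by means of a strictly
  increasing, right continuous function \<Phi> with \<Phi> (t + \<alpha>) = q \<Phi> t + (1 - q) \<lfloor>t\<rfloor> + \<delta>. It is the
  distribution function of point masses at \<alpha>, 2\<alpha>, 3\<alpha>, ... on the circle, so it jumps at a dense set of
  points. The Cantor set is the closure of the image of \<Phi>, and its gaps are the jumps. The only
  discontinuity of the process is the image of -\<alpha>, which is not a multiple n\<alpha> with n > 0 and hence not
  at the end of a gap. Therefore gaps are mapped into gaps, with lengths multiplied by q. Every orbit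
  enters the unit interval (orbit_enters_unit_interval), every point of that interval is a value of
  \<Phi> or lies in one of its jumps, and so every orbit follows an orbit of the rotation, with an error
  that tends to 0 (orbit_shadows_rotation).

  The three parts of chaos become statements about irrational rotations. Orbits of the rotation are
  dense, so the limit set of every orbit is the whole Cantor set. Two different phases are at some
  time separated by an integer, which puts the two orbits near opposite ends of the unit interval
  (orbits_separate). Finally, an interval pulls back under \<Phi> to an interval of phases, whose frequency
  is its length because the rotation is equidistributed (irrational_rotation_equidistributed).
\<close>

section \<open>Frequencies and equidistribution of irrational rotations\<close>

definition has_frequency :: "(nat \<Rightarrow> bool) \<Rightarrow> real \<Rightarrow> bool" where
  "has_frequency P c \<longleftrightarrow> (\<lambda>N. 1 / real N * real (card {n. n < N \<and> P n})) \<longlonglongrightarrow> c"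

lemma has_frequency_False: "has_frequency (\<lambda>_. False) 0"
  by (simp add: has_frequency_def)

lemma has_frequency_unique: "has_frequency P c \<Longrightarrow> has_frequency P d \<Longrightarrow> c = d"
  unfolding has_frequency_def by (rule LIMSEQ_unique)

lemma has_frequency_nonneg: "has_frequency P c \<Longrightarrow> 0 \<le> c"
  unfolding has_frequency_def by (rule LIMSEQ_le_const) auto

text \<open>
  Counting arguments below only control a sum over N steps up to an error that does not grow with
  N; such an error disappears from the averages.
\<close>

lemma bounded_perturbation_tendsto:
  fixes x y :: "nat \<Rightarrow> real"
  assumes "(\<lambda>N. x N / real N) \<longlonglongrightarrow> c" and "\<And>N. \<bar>x N - y N\<bar> \<le> B"
  shows "(\<lambda>N. y N / real N) \<longlonglongrightarrow> c"
proof -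
  have "(\<lambda>N. (x N - y N) / real N) \<longlonglongrightarrow> 0"
  proof (rule Lim_null_comparison)
    show "\<forall>\<^sub>F N in sequentially. norm ((x N - y N) / real N) \<le> B / real N"
      using assms(2) by (intro always_eventually allI) (simp add: divide_right_mono)
    show "(\<lambda>N. B / real N) \<longlonglongrightarrow> 0"
      by (rule lim_const_over_n)
  qed
  then have "(\<lambda>N. x N / real N - (x N - y N) / real N) \<longlonglongrightarrow> c - 0"
    by (intro tendsto_diff assms(1))
  then show ?thesis
    by (simp add: diff_divide_distrib)
qed

lemma has_frequency_finite_change:
  assumes "has_frequency P c" and "finite {n. P n \<noteq> Q n}"
  shows "has_frequency Q c"
proof -
  let ?E = "{n. P n \<noteq> Q n}"
  have *: "card {n. n < N \<and> R n} \<le> card {n. n < N \<and> R' n} + card ?E"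
    if "\<And>n. R n \<Longrightarrow> R' n \<or> n \<in> ?E" for N R R'
  proof -
    have "card {n. n < N \<and> R n} \<le> card ({n. n < N \<and> R' n} \<union> ?E)"
      using assms(2) that by (intro card_mono) auto
    then show ?thesis
      using card_Un_le order_trans by blast
  qed
  have "\<bar>real (card {n. n < N \<and> P n}) - real (card {n. n < N \<and> Q n})\<bar> \<le> real (card ?E)" for N
    using *[of P Q N] *[of Q P N] by auto
  then show ?thesis
    using bounded_perturbation_tendsto[of "\<lambda>N. real (card {n. n < N \<and> P n})" c
        "\<lambda>N. real (card {n. n < N \<and> Q n})" "real (card ?E)"] assms(1)
    unfolding has_frequency_def by simp
qed

lemma irrational_rotation_dense:
  fixes \<alpha> u v :: real
  assumes "\<alpha> \<notin> \<rat>" "u < v"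
  obtains k :: nat and m :: int where "u < real k * \<alpha> + of_int m" "real k * \<alpha> + of_int m < v"
proof -
  obtain h k where "k > 0" and k: "\<bar>of_int k * \<alpha> - of_int h - (u + v) / 2\<bar> < (v - u) / 2"
    using sequence_of_fractional_parts_is_dense[of \<alpha> "(v - u) / 2" "(u + v) / 2"] assms
    by (metis half_gt_zero diff_gt_0_iff_gt)
  have "real (nat k) = of_int k"
    using \<open>k > 0\<close> by simp
  with k show thesis
    by (intro that[of "nat k" "-h"]; simp add: abs_less_iff field_simps)
qed

text \<open>
  The quantity \<lfloor>x\<rfloor> - \<lfloor>x - \<alpha>\<rfloor> is a coboundary for the rotation by \<alpha>: along the orbit it telescopes, so
  its sum over N steps is N\<alpha> up to less than 1. Writing a shift by k\<alpha> as k successive shifts by \<alpha>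
  costs one such error for each of them. Intervals of length k\<alpha> (mod 1) are the bounded remainder sets of the rotation.
\<close>

lemma floor_rotation_sum:
  fixes \<alpha> t :: real
  shows "\<bar>(\<Sum>n<N. of_int (\<lfloor>t + real n * \<alpha>\<rfloor> - \<lfloor>t + real n * \<alpha> - real k * \<alpha>\<rfloor>)) - real N * (real k * \<alpha>)\<bar>
    \<le> real k"
proof (induction k arbitrary: t)
  case (Suc k)
  have telescope: "(\<Sum>n<N. \<lfloor>t + real n * \<alpha>\<rfloor> - \<lfloor>t + real n * \<alpha> - \<alpha>\<rfloor>)
      = \<lfloor>t + real N * \<alpha> - \<alpha>\<rfloor> - \<lfloor>t - \<alpha>\<rfloor>"
    by (induction N) (auto simp: algebra_simps)
  have "\<bar>real_of_int (\<Sum>n<N. \<lfloor>t + real n * \<alpha>\<rfloor> - \<lfloor>t + real n * \<alpha> - \<alpha>\<rfloor>) - real N * \<alpha>\<bar> \<le> 1"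
    unfolding telescope by linarith
  moreover note Suc.IH[of "t - \<alpha>"]
  moreover have "(\<Sum>n<N. real_of_int (\<lfloor>t + real n * \<alpha>\<rfloor> - \<lfloor>t + real n * \<alpha> - real (Suc k) * \<alpha>\<rfloor>))
     = real_of_int (\<Sum>n<N. \<lfloor>t + real n * \<alpha>\<rfloor> - \<lfloor>t + real n * \<alpha> - \<alpha>\<rfloor>)
       + (\<Sum>n<N. of_int (\<lfloor>t - \<alpha> + real n * \<alpha>\<rfloor> - \<lfloor>t - \<alpha> + real n * \<alpha> - real k * \<alpha>\<rfloor>))"
    unfolding of_int_sum sum.distrib[symmetric]
    by (intro sum.cong refl) (simp add: algebra_simps)
  ultimately show ?case
    by (simp add: algebra_simps)
qed simp

text \<open>
  For \<beta> = k\<alpha> + m the preceding bound gives the limit. These \<beta> are dense because \<alpha> is irrational, and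
  the averages are monotone in \<beta>, so every other \<beta> is squeezed between two of them.
\<close>

lemma floor_rotation_average:
  fixes \<alpha> \<beta> t :: real
  assumes "\<alpha> \<notin> \<rat>"
  shows "(\<lambda>N. (\<Sum>n<N. of_int (\<lfloor>t + real n * \<alpha>\<rfloor> - \<lfloor>t + real n * \<alpha> - \<beta>\<rfloor>)) / real N) \<longlonglongrightarrow> \<beta>"
    (is "?D \<beta> \<longlonglongrightarrow> _")
proof -
  have exact: "?D (real k * \<alpha> + of_int m) \<longlonglongrightarrow> real k * \<alpha> + of_int m" for k :: nat and m :: int
  proof (rule bounded_perturbation_tendsto)
    let ?\<beta> = "real k * \<alpha> + of_int m"
    show "(\<lambda>N. real N * ?\<beta> / real N) \<longlonglongrightarrow> ?\<beta>"
      by (rule tendsto_eventually) (auto simp: eventually_at_top_linorder intro!: exI[of _ 1])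
    fix N
    have "\<lfloor>x - ?\<beta>\<rfloor> = \<lfloor>x - real k * \<alpha>\<rfloor> - m" for x :: real
      using floor_diff_of_int[of "x - real k * \<alpha>" m] by (simp add: algebra_simps)
    then have "(\<Sum>n<N. real_of_int (\<lfloor>t + real n * \<alpha>\<rfloor> - \<lfloor>t + real n * \<alpha> - ?\<beta>\<rfloor>))
       = (\<Sum>n<N. of_int (\<lfloor>t + real n * \<alpha>\<rfloor> - \<lfloor>t + real n * \<alpha> - real k * \<alpha>\<rfloor>)) + real N * of_int m"
      by (simp add: sum.distrib sum_subtractf)
    then show "\<bar>real N * ?\<beta>
        - (\<Sum>n<N. of_int (\<lfloor>t + real n * \<alpha>\<rfloor> - \<lfloor>t + real n * \<alpha> - ?\<beta>\<rfloor>))\<bar> \<le> real k"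
      using floor_rotation_sum[of t \<alpha> k N] by (simp add: algebra_simps abs_le_iff)
  qed
  have mono: "?D \<beta> N \<le> ?D \<beta>' N" if "\<beta> \<le> \<beta>'" for \<beta> \<beta>' N
    using that by (intro divide_right_mono sum_mono) (auto intro: floor_mono)
  show ?thesis
  proof (rule order_tendstoI)
    fix l assume "l < \<beta>"
    then obtain k :: nat and m :: int where km: "l < real k * \<alpha> + of_int m" "real k * \<alpha> + of_int m < \<beta>"
      using irrational_rotation_dense[OF assms] by blast
    have "\<forall>\<^sub>F N in sequentially. l < ?D (real k * \<alpha> + of_int m) N"
      using order_tendstoD(1)[OF exact km(1)] .
    then show "\<forall>\<^sub>F N in sequentially. l < ?D \<beta> N"
      by eventually_elim (use mono[OF less_imp_le[OF km(2)]] in \<open>fastforce intro: less_le_trans\<close>)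
  next
    fix l assume "\<beta> < l"
    then obtain k :: nat and m :: int where km: "\<beta> < real k * \<alpha> + of_int m" "real k * \<alpha> + of_int m < l"
      using irrational_rotation_dense[OF assms] by blast
    have "\<forall>\<^sub>F N in sequentially. ?D (real k * \<alpha> + of_int m) N < l"
      using order_tendstoD(2)[OF exact km(2)] .
    then show "\<forall>\<^sub>F N in sequentially. ?D \<beta> N < l"
      by eventually_elim (use mono[OF less_imp_le[OF km(1)]] in \<open>fastforce intro: le_less_trans\<close>)
  qed
qed

text \<open>
  The indicator of a \<le> frac x < b is the difference of two of the functions averaged above.
\<close>

theorem irrational_rotation_equidistributed:
  fixes \<alpha> t a b :: real
  assumes "\<alpha> \<notin> \<rat>" "0 \<le> a" "a \<le> b" "b \<le> 1"
  shows "has_frequency (\<lambda>n. frac (t + real n * \<alpha>) \<in> {a..<b}) (b - a)"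
proof -
  have indicator: "of_bool (frac x \<in> {a..<b}) = (of_int (\<lfloor>x\<rfloor> - \<lfloor>x - b\<rfloor>) - of_int (\<lfloor>x\<rfloor> - \<lfloor>x - a\<rfloor>) :: real)"
    for x :: real
  proof -
    have "\<lfloor>x - c\<rfloor> = (if c \<le> frac x then \<lfloor>x\<rfloor> else \<lfloor>x\<rfloor> - 1)" if "0 \<le> c" "c \<le> 1" for c
      using that frac_lt_1[of x] by (auto simp: frac_def floor_eq_iff) linarith+
    then show ?thesis
      using assms by auto
  qed
  have "(\<lambda>N. (\<Sum>n<N. of_int (\<lfloor>t + real n * \<alpha>\<rfloor> - \<lfloor>t + real n * \<alpha> - b\<rfloor>)) / real N
      - (\<Sum>n<N. of_int (\<lfloor>t + real n * \<alpha>\<rfloor> - \<lfloor>t + real n * \<alpha> - a\<rfloor>)) / real N) \<longlonglongrightarrow> b - a"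
    by (intro tendsto_diff floor_rotation_average assms(1))
  moreover have "real (card {n. n < N \<and> frac (t + real n * \<alpha>) \<in> {a..<b}})
     = (\<Sum>n<N. of_bool (frac (t + real n * \<alpha>) \<in> {a..<b}))" for N
    by (simp add: sum_of_bool_eq Int_def lessThan_def)
  ultimately show ?thesis
    by (simp only: has_frequency_def indicator sum_subtractf diff_divide_distrib times_divide_eq_left mult_1)
qed

corollary irrational_rotation_infinitely_often:
  fixes \<alpha> t a b :: real
  assumes "\<alpha> \<notin> \<rat>" "0 \<le> a" "a < b" "b \<le> 1"
  shows "infinite {n. frac (t + real n * \<alpha>) \<in> {a<..<b}}"
proof
  let ?c = "(a + b) / 2"
  assume "finite {n. frac (t + real n * \<alpha>) \<in> {a<..<b}}"
  then have "finite {n. (frac (t + real n * \<alpha>) \<in> {?c..<b}) \<noteq> False}"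
    by (rule rev_finite_subset) (use assms in auto)
  moreover have "has_frequency (\<lambda>n. frac (t + real n * \<alpha>) \<in> {?c..<b}) (b - ?c)"
    using assms by (intro irrational_rotation_equidistributed) auto
  ultimately have "has_frequency (\<lambda>_. False) (b - ?c)"
    by (rule has_frequency_finite_change[rotated])
  then have "b - ?c = 0"
    using has_frequency_False by (rule has_frequency_unique)
  with assms(3) show False
    by simp
qed

lemma irrational_rotation_inj:
  fixes \<alpha> t :: real
  assumes "\<alpha> \<notin> \<rat>" "frac (t + real n * \<alpha>) = frac (t + real m * \<alpha>)"
  shows "n = m"
proof (rule ccontr)
  assume "n \<noteq> m"
  have "(real n - real m) * \<alpha> = of_int (\<lfloor>t + real n * \<alpha>\<rfloor> - \<lfloor>t + real m * \<alpha>\<rfloor>)"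
    using assms(2) by (simp add: frac_def algebra_simps)
  then have "\<alpha> = of_int (\<lfloor>t + real n * \<alpha>\<rfloor> - \<lfloor>t + real m * \<alpha>\<rfloor>) / of_int (int n - int m)"
    using \<open>n \<noteq> m\<close> by (simp add: field_simps)
  also have "\<dots> \<in> \<rat>"
    by (intro Rats_divide Rats_of_int)
  finally show False
    using assms(1) by simp
qed

corollary irrational_rotation_finitely_often:
  fixes \<alpha> t x :: real
  assumes "\<alpha> \<notin> \<rat>"
  shows "finite {n. frac (t + real n * \<alpha>) = x}"
proof (cases "\<exists>m. frac (t + real m * \<alpha>) = x")
  case True
  then obtain m where "frac (t + real m * \<alpha>) = x" ..
  then have "{n. frac (t + real n * \<alpha>) = x} \<subseteq> {m}"
    using irrational_rotation_inj[OF assms] by blast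
  then show ?thesis
    using finite_subset by blast
qed simp

text \<open>
  This makes the rotation number, 2 minus the golden ratio, irrational.
\<close>

lemma sqrt_5_irrational: "sqrt 5 \<notin> \<rat>"
proof
  assume "sqrt 5 \<in> \<rat>"
  then obtain m n :: nat where mn: "n \<noteq> 0" "\<bar>sqrt 5\<bar> = m / n" "coprime m n"
    by (rule Rats_abs_nat_div_natE)
  have "real (m ^ 2) = (sqrt 5)\<^sup>2 * real (n ^ 2)"
    using mn by (simp add: power_divide)
  then have "real (m ^ 2) = real (5 * n ^ 2)"
    by simp
  then have eq: "m ^ 2 = 5 * n ^ 2"
    by (simp only: of_nat_eq_iff)
  have p5: "prime (5 :: nat)"
    by simp
  then have "5 dvd m"
    using eq by (metis dvd_triv_left prime_dvd_power)
  then obtain k where "m = 5 * k" ..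
  with eq have "n ^ 2 = 5 * k ^ 2"
    by (simp add: power2_eq_square)
  then have "5 dvd n"
    using p5 by (metis dvd_triv_left prime_dvd_power)
  with \<open>5 dvd m\<close> mn(3) show False
    using coprime_common_divisor_nat by fastforce
qed

section \<open>The coding function of a contracted rotation\<close>

text \<open>
  A contracted rotation y \<mapsto> qy + \<delta> (mod 1) is described by its rotation number \<alpha> instead of its offset
  \<delta>: since \<alpha> is irrational, q and \<alpha> determine \<delta>.
\<close>

locale contracted_rotation =
  fixes q \<alpha> :: real
  assumes q_pos: "0 < q" and q_less_1: "q < 1"
    and irrational: "\<alpha> \<notin> \<rat>" and \<alpha>_pos: "0 < \<alpha>" and \<alpha>_less_1: "\<alpha> < 1"
begin

text \<open>
  The number of integers in the interval from s - (k+1)\<alpha> (excluded) to t - (k+1)\<alpha> (included) if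
  s \<le> t, that is, how often the interval from s to t meets the point (k+1)\<alpha> of the circle.
\<close>

definition crossings :: "real \<Rightarrow> real \<Rightarrow> nat \<Rightarrow> int" where
  "crossings s t k = \<lfloor>t - real (Suc k) * \<alpha>\<rfloor> - \<lfloor>s - real (Suc k) * \<alpha>\<rfloor>"

text \<open>
  On the unit interval this is the distribution function of the probability measure with mass
  (1 - q)q^k at the point (k+1)\<alpha> of the circle. It conjugates the rotation by \<alpha> to the contracted
  rotation; its jumps are the gaps of the attractor, and they fill the interval up to a null set.
\<close>

definition \<Phi> :: "real \<Rightarrow> real" where
  "\<Phi> t = (1 - q) * (\<Sum>k. q ^ k * of_int (crossings 0 t k))"

text \<open>
  The offset is \<Phi> \<alpha>, the image of the rotated point \<alpha> = 0 + \<alpha>, and the discontinuity is the image of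
  1 - \<alpha>, the point that the rotation carries to 1. Only for these values is the coding function a
  conjugacy. No reduction mod 1 is built in, so the map acts on the whole line.
\<close>

definition step :: "real \<Rightarrow> real" where
  "step y = (if y < \<Phi> (1 - \<alpha>) then q * y + \<Phi> \<alpha> else q * y + \<Phi> \<alpha> - 1)"

definition attractor :: "real set" where
  "attractor = closure (\<Phi> ` {0..<1})"

lemma crossings_bound: "\<bar>real_of_int (crossings s t k)\<bar> \<le> \<bar>t - s\<bar> + 1"
  unfolding crossings_def by linarith

lemma crossings_nonneg: "s \<le> t \<Longrightarrow> 0 \<le> crossings s t k"
  by (simp add: crossings_def floor_mono)

lemma summable_geometric_q: "summable (\<lambda>k. q ^ k)"
  using q_pos q_less_1 by (intro summable_geometric) auto

lemma summable_crossings: "summable (\<lambda>k. q ^ k * of_int (crossings s t k))"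
proof (rule summable_comparison_test')
  show "summable (\<lambda>k. q ^ k * (\<bar>t - s\<bar> + 1))"
    by (intro summable_mult2 summable_geometric_q)
  show "norm (q ^ k * of_int (crossings s t k)) \<le> q ^ k * (\<bar>t - s\<bar> + 1)" for k
    using q_pos crossings_bound[of s t k] by (simp add: abs_mult mult_left_mono)
qed

lemma \<Phi>_diff: "\<Phi> t - \<Phi> s = (1 - q) * (\<Sum>k. q ^ k * of_int (crossings s t k))"
proof -
  have "(\<Sum>k. q ^ k * of_int (crossings 0 t k)) - (\<Sum>k. q ^ k * of_int (crossings 0 s k))
     = (\<Sum>k. q ^ k * of_int (crossings 0 t k) - q ^ k * of_int (crossings 0 s k))"
    by (intro suminf_diff summable_crossings)
  also have "\<dots> = (\<Sum>k. q ^ k * of_int (crossings s t k))"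
    by (rule suminf_cong) (simp add: crossings_def algebra_simps)
  finally show ?thesis
    by (simp add: \<Phi>_def flip: right_diff_distrib)
qed

lemma \<Phi>_mono: "s \<le> t \<Longrightarrow> \<Phi> s \<le> \<Phi> t"
proof -
  assume "s \<le> t"
  then have "0 \<le> (\<Sum>k. q ^ k * of_int (crossings s t k))"
    using q_pos by (intro suminf_nonneg summable_crossings) (simp add: crossings_nonneg)
  then have "0 \<le> \<Phi> t - \<Phi> s"
    unfolding \<Phi>_diff using q_less_1 by (intro mult_nonneg_nonneg) auto
  then show "\<Phi> s \<le> \<Phi> t"
    by simp
qed

text \<open>
  All summands of \<Phi> t - \<Phi> s are nonnegative, so one atom between s and t bounds the difference from
  below. This is the source both of strict monotonicity and of the gaps of the attractor.
\<close>

lemma \<Phi>_jump: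
  assumes "s - real (Suc k) * \<alpha> < of_int m" "of_int m \<le> t - real (Suc k) * \<alpha>"
  shows "\<Phi> s + (1 - q) * q ^ k \<le> \<Phi> t"
proof -
  have "s \<le> t"
    using assms by linarith
  have "\<lfloor>s - real (Suc k) * \<alpha>\<rfloor> < m" "m \<le> \<lfloor>t - real (Suc k) * \<alpha>\<rfloor>"
    using assms by (simp_all only: floor_less_iff le_floor_iff)
  then have "1 \<le> crossings s t k"
    unfolding crossings_def by linarith
  then have "q ^ k \<le> q ^ k * of_int (crossings s t k)"
    using q_pos by simp
  also have "\<dots> \<le> (\<Sum>j. q ^ j * of_int (crossings s t j))"
    using sum_le_suminf[OF summable_crossings[of s t], of "{k}"] q_pos crossings_nonneg[OF \<open>s \<le> t\<close>]
    by simp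
  finally have "(1 - q) * q ^ k \<le> \<Phi> t - \<Phi> s"
    unfolding \<Phi>_diff using q_less_1 by (intro mult_left_mono) auto
  then show ?thesis
    by simp
qed

text \<open>
  The atoms (k+1)\<alpha> are dense because \<alpha> is irrational. They are reached as the orbit of t - \<alpha> under the
  rotation by -\<alpha>: some orbit point lies in the circle just above an integer.
\<close>

lemma \<Phi>_strict_mono:
  assumes "s < t"
  shows "\<Phi> s < \<Phi> t"
proof -
  let ?d = "min 1 (t - s)"
  have "- \<alpha> \<notin> \<rat>"
    using irrational Rats_minus_iff by blast
  then have "infinite {n. frac (t - \<alpha> + real n * (-\<alpha>)) \<in> {0<..<?d}}"
    using assms by (intro irrational_rotation_infinitely_often) auto
  then obtain k where "frac (t - \<alpha> + real k * (-\<alpha>)) \<in> {0<..<?d}"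
    using not_finite_existsD by auto
  then have "\<Phi> s + (1 - q) * q ^ k \<le> \<Phi> t"
    by (intro \<Phi>_jump[of _ _ "\<lfloor>t - \<alpha> + real k * (-\<alpha>)\<rfloor>"]) (auto simp: frac_def algebra_simps)
  moreover have "0 < (1 - q) * q ^ k"
    using q_pos q_less_1 by simp
  ultimately show ?thesis
    by linarith
qed

lemma \<Phi>_le_iff: "\<Phi> s \<le> \<Phi> t \<longleftrightarrow> s \<le> t"
  by (meson \<Phi>_mono \<Phi>_strict_mono not_le)

lemma \<Phi>_less_iff: "\<Phi> s < \<Phi> t \<longleftrightarrow> s < t"
  by (meson \<Phi>_le_iff not_le)

lemma \<Phi>_0: "\<Phi> 0 = 0"
  by (simp add: \<Phi>_def crossings_def)

lemma \<Phi>_add_1: "\<Phi> (t + 1) = \<Phi> t + 1"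
proof -
  have "crossings t (t + 1) k = 1" for k
    by (simp add: crossings_def algebra_simps flip: floor_add_int) linarith
  then have "\<Phi> (t + 1) - \<Phi> t = (1 - q) * (\<Sum>k. q ^ k)"
    by (simp add: \<Phi>_diff)
  also have "\<dots> = 1"
    using q_pos q_less_1 by (simp add: suminf_geometric)
  finally show ?thesis
    by simp
qed

lemma \<Phi>_1: "\<Phi> 1 = 1"
  using \<Phi>_add_1[of 0] \<Phi>_0 by simp

text \<open>
  Shifting t by \<alpha> moves every summand one place to the right, which multiplies the series by q, and
  creates the new leading term \<lfloor>t\<rfloor>.
\<close>

lemma \<Phi>_add_\<alpha>: "\<Phi> (t + \<alpha>) = q * \<Phi> t + (1 - q) * of_int \<lfloor>t\<rfloor> + \<Phi> \<alpha>"
proof -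
  have first: "crossings \<alpha> (t + \<alpha>) 0 = \<lfloor>t\<rfloor>"
    and rest: "crossings \<alpha> (t + \<alpha>) (Suc k) = crossings 0 t k" for k
    by (simp_all add: crossings_def algebra_simps)
  have "(\<Sum>k. q ^ k * of_int (crossings \<alpha> (t + \<alpha>) k))
     = (\<Sum>k. q ^ Suc k * of_int (crossings \<alpha> (t + \<alpha>) (Suc k))) + of_int \<lfloor>t\<rfloor>"
    using suminf_split_head[OF summable_crossings[of \<alpha> "t + \<alpha>"]] first by simp
  also have "(\<Sum>k. q ^ Suc k * of_int (crossings \<alpha> (t + \<alpha>) (Suc k)))
     = q * (\<Sum>k. q ^ k * of_int (crossings 0 t k))"
    unfolding rest power_Suc mult.assoc by (rule suminf_mult[OF summable_crossings])
  finally have "\<Phi> (t + \<alpha>) - \<Phi> \<alpha> = (1 - q) * (q * (\<Sum>k. q ^ k * of_int (crossings 0 t k)) + of_int \<lfloor>t\<rfloor>)"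
    using \<Phi>_diff[of "t + \<alpha>" \<alpha>] by simp
  then show ?thesis
    by (simp add: \<Phi>_def algebra_simps)
qed

lemma threshold: "q * \<Phi> (1 - \<alpha>) = 1 - \<Phi> \<alpha>"
proof -
  have "\<lfloor>1 - \<alpha>\<rfloor> = 0"
    using \<alpha>_pos \<alpha>_less_1 by (intro floor_unique) auto
  then show ?thesis
    using \<Phi>_add_\<alpha>[of "1 - \<alpha>"] \<Phi>_1 by simp
qed

lemma \<Phi>_\<alpha>_pos: "0 < \<Phi> \<alpha>"
  using \<Phi>_strict_mono[OF \<alpha>_pos] \<Phi>_0 by simp

lemma \<Phi>_\<alpha>_less_1: "\<Phi> \<alpha> < 1"
  using \<Phi>_strict_mono[OF \<alpha>_less_1] \<Phi>_1 by simp

lemma threshold_pos: "0 < \<Phi> (1 - \<alpha>)"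
  using \<Phi>_strict_mono[of 0 "1 - \<alpha>"] \<alpha>_less_1 \<Phi>_0 by simp

lemma threshold_less_1: "\<Phi> (1 - \<alpha>) < 1"
  using \<Phi>_strict_mono[of "1 - \<alpha>" 1] \<alpha>_pos \<Phi>_1 by simp

text \<open>
  Each summand is locally constant along the filter and the geometric weights dominate the series,
  so the limit may be taken inside. This covers one-sided continuity in both directions.
\<close>

lemma \<Phi>_tendsto:
  assumes floors: "\<And>k. \<forall>\<^sub>F s in F. \<lfloor>s - real (Suc k) * \<alpha>\<rfloor> = \<lfloor>t - real (Suc k) * \<alpha>\<rfloor>"
    and near: "\<forall>\<^sub>F s in F. \<bar>s - t\<bar> \<le> 1" and "F \<noteq> bot"
  shows "(\<Phi> \<longlongrightarrow> \<Phi> t) F"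
proof -
  have "((\<lambda>s. \<Sum>k. q ^ k * of_int (crossings t s k)) \<longlongrightarrow> (\<Sum>k::nat. 0::real)) F"
  proof (rule conjunct2[OF conjunct2[OF tannerys_theorem]])
    show "((\<lambda>s. q ^ k * of_int (crossings t s k)) \<longlongrightarrow> 0) F" for k
      by (rule tendsto_eventually, use floors[of k] in eventually_elim) (simp add: crossings_def)
    have "\<forall>\<^sub>F s in F. \<forall>k. norm (q ^ k * of_int (crossings t s k)) \<le> q ^ k * 2"
      using near
    proof eventually_elim
      case (elim s)
      show ?case
      proof
        fix k
        show "norm (q ^ k * of_int (crossings t s k)) \<le> q ^ k * 2"
          using q_pos crossings_bound[of t s k] elim by (simp add: abs_mult)
      qed
    qed
    then show "\<forall>\<^sub>F (k, s) in at_top \<times>\<^sub>F F. norm (q ^ k * of_int (crossings t s k)) \<le> q ^ k * 2"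
      unfolding eventually_prod_filter
      by (intro exI[of _ "\<lambda>_. True"] exI[of _ "\<lambda>s. \<forall>k. norm (q ^ k * of_int (crossings t s k)) \<le> q ^ k * 2"])
        auto
    show "summable (\<lambda>k. q ^ k * 2)"
      by (intro summable_mult2 summable_geometric_q)
  qed fact
  then have "((\<lambda>s. \<Phi> t + (1 - q) * (\<Sum>k. q ^ k * of_int (crossings t s k))) \<longlongrightarrow> \<Phi> t + (1 - q) * 0) F"
    by (intro tendsto_intros) simp
  then show ?thesis
    by (simp flip: \<Phi>_diff)
qed

lemma \<Phi>_right_continuous: "(\<Phi> \<longlongrightarrow> \<Phi> t) (at_right t)"
proof (rule \<Phi>_tendsto)
  show "\<forall>\<^sub>F s in at_right t. \<lfloor>s - real (Suc k) * \<alpha>\<rfloor> = \<lfloor>t - real (Suc k) * \<alpha>\<rfloor>" for k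
  proof -
    have "\<forall>\<^sub>F s in at_right t. t < s \<and> s < of_int (\<lfloor>t - real (Suc k) * \<alpha>\<rfloor> + 1) + real (Suc k) * \<alpha>"
      by (intro eventually_conj eventually_at_right_less eventually_at_right_real[THEN eventually_mono])
        (auto, linarith)
    then show ?thesis
      by eventually_elim (simp add: floor_eq_iff, linarith)
  qed
  show "\<forall>\<^sub>F s in at_right t. \<bar>s - t\<bar> \<le> 1"
    using eventually_at_right_real[of t "t + 1"] by (auto elim!: eventually_mono)
qed simp

text \<open>
  The atoms sit at the positive multiples of \<alpha>, and 1 - \<alpha> is a negative one. Hence the discontinuity of
  the contracted rotation is not an end point of a gap, and it never separates two points of the same gap.
\<close>

lemma \<Phi>_left_continuous_threshold: "(\<Phi> \<longlongrightarrow> \<Phi> (1 - \<alpha>)) (at_left (1 - \<alpha>))"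
proof (rule \<Phi>_tendsto)
  show "\<forall>\<^sub>F s in at_left (1 - \<alpha>). \<lfloor>s - real (Suc k) * \<alpha>\<rfloor> = \<lfloor>1 - \<alpha> - real (Suc k) * \<alpha>\<rfloor>" for k
  proof (rule eventually_floor_eq)
    show "((\<lambda>s. s - real (Suc k) * \<alpha>) \<longlongrightarrow> 1 - \<alpha> - real (Suc k) * \<alpha>) (at_left (1 - \<alpha>))"
      by (intro tendsto_intros)
    show "1 - \<alpha> - real (Suc k) * \<alpha> \<notin> \<int>"
    proof
      assume "1 - \<alpha> - real (Suc k) * \<alpha> \<in> \<int>"
      then obtain m where "1 - \<alpha> - real (Suc k) * \<alpha> = of_int m"
        by (auto elim: Ints_cases)
      then have "\<alpha> = of_int (1 - m) / of_int (int k + 2)"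
        by (simp add: field_simps)
      also have "\<dots> \<in> \<rat>"
        by (intro Rats_divide Rats_of_int)
      finally show False
        using irrational by simp
    qed
  qed
  show "\<forall>\<^sub>F s in at_left (1 - \<alpha>). \<bar>s - (1 - \<alpha>)\<bar> \<le> 1"
    using eventually_at_left_real[of "- \<alpha>" "1 - \<alpha>"] by (auto elim!: eventually_mono)
qed simp

section \<open>Every orbit follows an orbit of the rotation\<close>

text \<open>
  The point y lies in the closed jump of \<Phi> at t, between the left limit at t and the value. The left
  limit is avoided by quantifying over smaller arguments. The parameter t = 1 is included so that
  y = 1, a point of the attractor outside the image of \<Phi>, is covered as well.
\<close>

definition trapped :: "real \<Rightarrow> real \<Rightarrow> bool" where
  "trapped y t \<longleftrightarrow> 0 \<le> y \<and> y \<le> \<Phi> t \<and> 0 \<le> t \<and> t \<le> 1 \<and> (\<forall>s. 0 \<le> s \<and> s < t \<longrightarrow> \<Phi> s \<le> y)"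

lemma trapped_\<Phi>: "0 \<le> t \<Longrightarrow> t \<le> 1 \<Longrightarrow> trapped (\<Phi> t) t"
  using \<Phi>_mono[of 0 t] \<Phi>_0 by (auto simp: trapped_def \<Phi>_mono)

text \<open>
  The witness is the generalized inverse of \<Phi>; right continuity puts y below the value of \<Phi> there.
\<close>

lemma trapped_exists:
  assumes "0 \<le> y" "y \<le> 1"
  obtains t where "trapped y t"
proof
  let ?T = "{s. 0 \<le> s \<and> s \<le> 1 \<and> y \<le> \<Phi> s}"
  have ne: "1 \<in> ?T" and bdd: "bdd_below ?T"
    using assms \<Phi>_1 by (auto intro: bdd_belowI[of _ 0])
  have le1: "Inf ?T \<le> 1"
    using ne bdd by (rule cInf_lower)
  have ge0: "0 \<le> Inf ?T"
    using ne by (intro cInf_greatest) auto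
  have below: "\<Phi> s \<le> y" if "0 \<le> s" "s < Inf ?T" for s
    using cInf_lower[OF _ bdd, of s] that le1 by fastforce
  have "y \<le> \<Phi> (Inf ?T)"
  proof (rule ccontr)
    assume "\<not> y \<le> \<Phi> (Inf ?T)"
    then have "\<forall>\<^sub>F s in at_right (Inf ?T). \<Phi> s < y"
      by (intro order_tendstoD(2)[OF \<Phi>_right_continuous]) simp
    then obtain b where b: "b > Inf ?T" "\<And>s. Inf ?T < s \<Longrightarrow> s < b \<Longrightarrow> \<Phi> s < y"
      by (auto simp: eventually_at_right_field)
    obtain s where "s \<in> ?T" "s < b"
      using cInf_lessD[of ?T b] ne b(1) by blast
    moreover have "Inf ?T \<le> s"
      using \<open>s \<in> ?T\<close> bdd by (rule cInf_lower)
    ultimately show False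
      using b(2)[of s] \<open>\<not> y \<le> \<Phi> (Inf ?T)\<close> by (cases "s = Inf ?T") auto
  qed
  then show "trapped y (Inf ?T)"
    using assms le1 ge0 below by (simp add: trapped_def)
qed

text \<open>
  The step maps the jump of \<Phi> at t into the jump at t + \<alpha>. It preserves the order on each of the two
  branches, and y and t lie on the same branch: this could fail only for t = 1 - \<alpha> and y strictly below
  \<Phi> (1 - \<alpha>), which left continuity excludes. The distance to the upper end of the jump shrinks by q
  because both points undergo the same affine map; for t = 1 the upper end is treated as a point on
  the next turn of the circle, so the identity starts one step later.
\<close>

lemma trapped_step:
  assumes "trapped y t"
  shows "trapped (step y) (frac (t + \<alpha>))"
    and "t < 1 \<Longrightarrow> \<Phi> (frac (t + \<alpha>)) - step y = q * (\<Phi> t - y)"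
proof -
  have y: "0 \<le> y" "y \<le> \<Phi> t" and t: "0 \<le> t" "t \<le> 1"
    and below: "\<And>s. 0 \<le> s \<Longrightarrow> s < t \<Longrightarrow> \<Phi> s \<le> y"
    using assms by (auto simp: trapped_def)
  have "trapped (step y) (frac (t + \<alpha>)) \<and> (t < 1 \<longrightarrow> \<Phi> (frac (t + \<alpha>)) - step y = q * (\<Phi> t - y))"
  proof (cases "y < \<Phi> (1 - \<alpha>)")
    case True
    have "t \<le> 1 - \<alpha>"
      using below[of "1 - \<alpha>"] True \<alpha>_less_1 by fastforce
    moreover have "t \<noteq> 1 - \<alpha>"
    proof
      assume "t = 1 - \<alpha>"
      have "\<forall>\<^sub>F s in at_left (1 - \<alpha>). y < \<Phi> s"
        using order_tendstoD(1)[OF \<Phi>_left_continuous_threshold True] .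
      moreover have "\<forall>\<^sub>F s in at_left (1 - \<alpha>). s \<in> {0<..<1 - \<alpha>}"
        using \<alpha>_less_1 by (intro eventually_at_left_real) simp
      ultimately have "\<forall>\<^sub>F s in at_left (1 - \<alpha>). False"
      proof eventually_elim
        case (elim s)
        then show False
          using below[of s] \<open>t = 1 - \<alpha>\<close> by simp
      qed
      then show False
        by (simp add: trivial_limit_at_left_real)
    qed
    ultimately have lt: "t + \<alpha> < 1"
      by simp
    then have fr: "frac (t + \<alpha>) = t + \<alpha>"
      using t \<alpha>_pos by (simp add: frac_eq)
    have fl: "\<lfloor>t\<rfloor> = 0"
      using t lt \<alpha>_pos by (simp add: floor_eq_iff)
    have gy: "step y = q * y + \<Phi> \<alpha>"
      using True by (simp add: step_def)
    have "\<Phi> s \<le> step y" if "0 \<le> s" "s < t + \<alpha>" for s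
    proof (cases "s < \<alpha>")
      case True
      then show ?thesis
        using \<Phi>_mono[of s \<alpha>] q_pos y(1) by (simp add: gy add_increasing)
    next
      case False
      then have "\<Phi> s = q * \<Phi> (s - \<alpha>) + \<Phi> \<alpha>"
        using \<Phi>_add_\<alpha>[of "s - \<alpha>"] that lt \<alpha>_pos by (simp add: floor_eq_iff)
      then show ?thesis
        using below[of "s - \<alpha>"] False that q_pos by (simp add: gy)
    qed
    then show ?thesis
      using \<Phi>_add_\<alpha>[of t] y t q_pos lt \<alpha>_pos \<Phi>_\<alpha>_pos
      by (simp add: trapped_def fr fl gy algebra_simps)
  next
    case False
    then have ge: "1 \<le> t + \<alpha>"
      using y(2) \<Phi>_less_iff[of t "1 - \<alpha>"] by linarith
    then have fr: "frac (t + \<alpha>) = t + \<alpha> - 1"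
      using t \<alpha>_less_1 by (simp add: frac_unique_iff)
    have gy: "step y = q * y + \<Phi> \<alpha> - 1"
      using False by (simp add: step_def)
    have shift: "\<Phi> (s - 1) = \<Phi> s - 1" for s
      using \<Phi>_add_1[of "s - 1"] by simp
    have "0 \<le> step y"
      using False threshold mult_left_mono[of "\<Phi> (1 - \<alpha>)" y q] q_pos by (simp add: gy)
    moreover have "\<Phi> s \<le> step y" if "0 \<le> s" "s < t + \<alpha> - 1" for s
    proof -
      have "\<Phi> s + 1 = q * \<Phi> (s + 1 - \<alpha>) + \<Phi> \<alpha>"
        using \<Phi>_add_\<alpha>[of "s + 1 - \<alpha>"] \<Phi>_add_1[of s] that t \<alpha>_less_1 by (simp add: floor_eq_iff)
      moreover have "q * \<Phi> (s + 1 - \<alpha>) \<le> q * y"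
        using below[of "s + 1 - \<alpha>"] that q_pos \<alpha>_less_1 by simp
      ultimately show ?thesis
        by (simp add: gy)
    qed
    moreover have image: "\<Phi> (t + \<alpha> - 1) = q * \<Phi> t + (1 - q) * of_int \<lfloor>t\<rfloor> + \<Phi> \<alpha> - 1"
      using \<Phi>_add_\<alpha>[of t] shift[of "t + \<alpha>"] by simp
    moreover have "step y \<le> \<Phi> (t + \<alpha> - 1)"
    proof -
      have "q * y \<le> q * \<Phi> t" "0 \<le> (1 - q) * of_int \<lfloor>t\<rfloor>"
        using y(2) t q_pos q_less_1 by simp_all
      then show ?thesis
        unfolding image gy by linarith
    qed
    moreover have "t < 1 \<Longrightarrow> \<lfloor>t\<rfloor> = 0"
      using t by (simp add: floor_eq_iff)
    moreover have "0 \<le> t + \<alpha> - 1" "t + \<alpha> - 1 \<le> 1"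
      using ge t \<alpha>_less_1 by auto
    ultimately show ?thesis
      unfolding trapped_def fr gy by (simp add: right_diff_distrib)
  qed
  then show "trapped (step y) (frac (t + \<alpha>))"
    and "t < 1 \<Longrightarrow> \<Phi> (frac (t + \<alpha>)) - step y = q * (\<Phi> t - y)"
    by auto
qed


lemma frac_add_frac: "frac (frac x + y) = frac (x + y)" for x y :: real
proof -
  have "frac x + y - frac (x + y) = of_int (\<lfloor>x + y\<rfloor> - \<lfloor>x\<rfloor>)"
    by (simp add: frac_def)
  then show ?thesis
    unfolding frac_unique_iff by (simp only: Ints_of_int frac_ge_0 frac_lt_1 simp_thms)
qed

lemma trapped_orbit:
  assumes "trapped y t"
  shows "trapped ((step ^^ Suc n) y) (frac (t + real (Suc n) * \<alpha>))"
    and "\<Phi> (frac (t + real (Suc n) * \<alpha>)) - (step ^^ Suc n) y = q ^ n * (\<Phi> (frac (t + \<alpha>)) - step y)"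
proof -
  have "trapped ((step ^^ Suc n) y) (frac (t + real (Suc n) * \<alpha>)) \<and>
    \<Phi> (frac (t + real (Suc n) * \<alpha>)) - (step ^^ Suc n) y = q ^ n * (\<Phi> (frac (t + \<alpha>)) - step y)"
  proof (induction n)
    case 0
    show ?case
      using trapped_step[OF assms] by simp
  next
    case (Suc n)
    have "frac (frac (t + real (Suc n) * \<alpha>) + \<alpha>) = frac (t + real (Suc (Suc n)) * \<alpha>)"
      by (simp add: frac_add_frac algebra_simps)
    then show ?case
      using trapped_step[OF conjunct1[OF Suc.IH]] Suc.IH frac_lt_1[of "t + real (Suc n) * \<alpha>"]
      by (simp add: mult.assoc)
  qed
  then show "trapped ((step ^^ Suc n) y) (frac (t + real (Suc n) * \<alpha>))"
    and "\<Phi> (frac (t + real (Suc n) * \<alpha>)) - (step ^^ Suc n) y = q ^ n * (\<Phi> (frac (t + \<alpha>)) - step y)"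
    by auto
qed

text \<open>
  Below 0 the map increases y by at least \<Phi> \<alpha> but keeps it below 1; above 1 it decreases y by at least
  1 - \<Phi> \<alpha> but keeps it positive. So no orbit can jump over the unit interval.
\<close>

lemma orbit_enters_unit_interval: "\<exists>n. (step ^^ n) y \<in> {0..1}"
proof (rule ccontr)
  assume "\<not> ?thesis"
  then have out: "(step ^^ n) y < 0 \<or> 1 < (step ^^ n) y" for n
    by (metis atLeastAtMost_iff not_le)
  have up: "x + \<Phi> \<alpha> \<le> step x" "step x < 1" if "x < 0" for x
  proof -
    have "step x = q * x + \<Phi> \<alpha>"
      using that threshold_pos by (simp add: step_def)
    moreover have "x \<le> q * x" "q * x < 0"
      using that q_less_1 q_pos by (auto simp: mult_less_0_iff)
    ultimately show "x + \<Phi> \<alpha> \<le> step x" "step x < 1"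
      using \<Phi>_\<alpha>_less_1 by linarith+
  qed
  have down: "step x \<le> x - (1 - \<Phi> \<alpha>)" "0 < step x" if "1 < x" for x
  proof -
    have "step x = q * x + \<Phi> \<alpha> - 1"
      using that threshold_less_1 by (simp add: step_def)
    moreover have "q * x \<le> x" "q < q * x"
      using that q_less_1 q_pos by auto
    moreover have "q * \<Phi> (1 - \<alpha>) < q"
      using threshold_less_1 q_pos by simp
    ultimately show "step x \<le> x - (1 - \<Phi> \<alpha>)" "0 < step x"
      using threshold by linarith+
  qed
  have "\<exists>n. (step ^^ n) y \<ge> 0"
  proof (rule ccontr)
    assume "\<not> ?thesis"
    then have neg: "(step ^^ n) y < 0" for n
      by (simp add: not_le)
    have "y + real n * \<Phi> \<alpha> \<le> (step ^^ n) y" for n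
    proof (induction n)
      case (Suc n)
      then show ?case
        using up(1)[OF neg[of n]] by (simp add: algebra_simps)
    qed simp
    then have "real n * \<Phi> \<alpha> < - y" for n
      using neg[of n] by (smt (verit))
    then show False
      using reals_Archimedean3[OF \<Phi>_\<alpha>_pos] by (meson less_asym)
  qed
  then obtain m where m: "1 < (step ^^ m) y"
    using out by (metis not_le)
  have big: "1 < (step ^^ (n + m)) y \<and> (step ^^ (n + m)) y \<le> (step ^^ m) y - real n * (1 - \<Phi> \<alpha>)" for n
  proof (induction n)
    case (Suc n)
    then show ?case
      using down[of "(step ^^ (n + m)) y"] out[of "Suc n + m"] by (simp add: algebra_simps)
  qed (use m in simp)
  then have "real n * (1 - \<Phi> \<alpha>) < (step ^^ m) y" for n
    by (smt (verit))
  then show False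
    using reals_Archimedean3[of "1 - \<Phi> \<alpha>"] \<Phi>_\<alpha>_less_1 by (meson diff_gt_0_iff_gt less_asym)
qed

text \<open>
  All orbits have the same asymptotic behaviour as an orbit of the rotation, and only the starting
  phase t depends on the orbit. The phase is shifted back by the time of entry, so that the indices
  of the two orbits agree.
\<close>

lemma orbit_shadows_rotation:
  obtains t N where "\<And>n. N \<le> n \<Longrightarrow> trapped ((step ^^ n) y) (frac (t + real n * \<alpha>))"
    and "(\<lambda>n. \<Phi> (frac (t + real n * \<alpha>)) - (step ^^ n) y) \<longlonglongrightarrow> 0"
proof -
  obtain M where "(step ^^ M) y \<in> {0..1}"
    using orbit_enters_unit_interval by blast
  then obtain t where t: "trapped ((step ^^ M) y) t"
    using trapped_exists by auto
  \<comment> \<open>the phase at time 0 that leads to t at time M\<close>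
  define t' where "t' = t - real M * \<alpha>"
  have shift: "(step ^^ (n + Suc M)) y = (step ^^ Suc n) ((step ^^ M) y)"
    "t' + real (n + Suc M) * \<alpha> = t + real (Suc n) * \<alpha>" for n
    using funpow_add[of "Suc n" M step] by (simp_all add: t'_def algebra_simps)
  show thesis
  proof (rule that)
    show "trapped ((step ^^ n) y) (frac (t' + real n * \<alpha>))" if "Suc M \<le> n" for n
      using trapped_orbit(1)[OF t, of "n - Suc M"] that unfolding shift[symmetric] by simp
    show "(\<lambda>n. \<Phi> (frac (t' + real n * \<alpha>)) - (step ^^ n) y) \<longlonglongrightarrow> 0"
    proof (rule LIMSEQ_offset[where k = "Suc M"], unfold shift trapped_orbit(2)[OF t])
      show "(\<lambda>n. q ^ n * (\<Phi> (frac (t + \<alpha>)) - step ((step ^^ M) y))) \<longlonglongrightarrow> 0"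
        using q_pos q_less_1 by (intro tendsto_mult_left_zero LIMSEQ_power_zero) auto
    qed
  qed
qed

section \<open>The attractor is a Cantor set\<close>

lemma \<Phi>_right_near:
  assumes "s < 1" "0 < \<epsilon>"
  obtains b where "s < b" "b \<le> 1" "\<And>s'. s < s' \<Longrightarrow> s' < b \<Longrightarrow> \<Phi> s' < \<Phi> s + \<epsilon>"
proof -
  have "\<forall>\<^sub>F s' in at_right s. \<Phi> s' < \<Phi> s + \<epsilon>"
    using assms(2) by (intro order_tendstoD(2)[OF \<Phi>_right_continuous]) simp
  then obtain b where "s < b" "\<And>s'. s < s' \<Longrightarrow> s' < b \<Longrightarrow> \<Phi> s' < \<Phi> s + \<epsilon>"
    by (auto simp: eventually_at_right_field)
  then show thesis
    using assms(1) by (intro that[of "min b 1"]) auto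
qed

lemma attractor_subset: "attractor \<subseteq> {0..1}"
proof -
  have "\<Phi> ` {0..<1} \<subseteq> {0..1}"
    using \<Phi>_mono[of 0] \<Phi>_mono[of _ 1] \<Phi>_0 \<Phi>_1 by auto
  then show ?thesis
    unfolding attractor_def by (rule closure_minimal) simp
qed

text \<open>
  A value of \<Phi> is approached from above by other values, since \<Phi> is right continuous and strictly
  increasing; the remaining points of the closure are limit points by definition.
\<close>

lemma attractor_islimpt:
  assumes "x \<in> attractor"
  shows "x islimpt \<Phi> ` {0..<1}"
proof (cases "x \<in> \<Phi> ` {0..<1}")
  case True
  then obtain s where s: "x = \<Phi> s" "0 \<le> s" "s < 1"
    by auto
  show ?thesis
    unfolding islimpt_approachable
  proof (intro allI impI)
    fix e :: real assume "0 < e"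
    then obtain b where b: "s < b" "b \<le> 1" "\<And>s'. s < s' \<Longrightarrow> s' < b \<Longrightarrow> \<Phi> s' < \<Phi> s + e"
      using \<Phi>_right_near[OF s(3)] by blast
    let ?s = "(s + b) / 2"
    have "\<Phi> s < \<Phi> ?s" "\<Phi> ?s < \<Phi> s + e" "?s \<in> {0..<1}"
      using b s by (auto intro: \<Phi>_strict_mono)
    then show "\<exists>x'\<in>\<Phi> ` {0..<1}. x' \<noteq> x \<and> dist x' x < e"
      by (intro bexI[of _ "\<Phi> ?s"]) (auto simp: s dist_real_def)
  qed
next
  case False
  then show ?thesis
    using assms by (simp add: attractor_def closure_def)
qed

text \<open>
  Every interval around a value \<Phi> s contains a value at some atom r slightly above s, because the
  atoms are dense. The jump of \<Phi> at r leaves an open gap directly below \<Phi> r.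
\<close>

lemma interior_attractor: "interior attractor = {}"
proof (rule ccontr)
  assume "interior attractor \<noteq> {}"
  then have "interior attractor \<inter> attractor \<noteq> {}"
    using interior_subset by blast
  then have "interior attractor \<inter> \<Phi> ` {0..<1} \<noteq> {}"
    using open_Int_closure_eq_empty[OF open_interior] unfolding attractor_def by blast
  then obtain s where s: "0 \<le> s" "s < 1" "\<Phi> s \<in> interior attractor"
    by auto
  then obtain e where e: "0 < e" "ball (\<Phi> s) e \<subseteq> attractor"
    using mem_interior by blast
  obtain b where b: "s < b" "b \<le> 1" "\<And>s'. s < s' \<Longrightarrow> s' < b \<Longrightarrow> \<Phi> s' < \<Phi> s + e"
    using \<Phi>_right_near[OF s(2) e(1)] by blast
  obtain n where n: "frac (0 + real n * \<alpha>) \<in> {s<..<b}"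
    using irrational_rotation_infinitely_often[OF irrational s(1) b(1,2)] not_finite_existsD by blast
  define r where "r = frac (real n * \<alpha>)"
  have r: "s < r" "r < b"
    using n by (simp_all add: r_def)
  have "n \<noteq> 0"
    using r s by (cases n) (auto simp: r_def)
  \<comment> \<open>n = 0 gives the phase 0, which carries no atom\<close>
  then obtain k where k: "n = Suc k"
    using not0_implies_Suc by blast
  define d where "d = (1 - q) * q ^ k"
  have "0 < d"
    using q_pos q_less_1 by (simp add: d_def)
  have gap: "\<Phi> s' \<le> \<Phi> r - d" if "s' < r" for s'
    using \<Phi>_jump[of s' k "- \<lfloor>real n * \<alpha>\<rfloor>" r] that by (simp add: k d_def r_def frac_def)
  let ?V = "{max (\<Phi> s) (\<Phi> r - d)<..<\<Phi> r}"
  have "\<Phi> s' \<notin> ?V" for s'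
    using gap[of s'] \<Phi>_mono[of r s'] by (cases "s' < r") auto
  then have "?V \<inter> \<Phi> ` {0..<1} = {}"
    by blast
  then have "?V \<inter> attractor = {}"
    unfolding attractor_def by (subst open_Int_closure_eq_empty) auto
  moreover have "?V \<subseteq> attractor"
    using e(2) b(3)[OF r] by (force simp: dist_real_def)
  moreover have "?V \<noteq> {}"
    using \<Phi>_strict_mono[OF r(1)] \<open>0 < d\<close> by simp
  ultimately show False
    by blast
qed

theorem cantor_set_attractor: "cantor_set attractor"
proof -
  have "attractor \<noteq> {}"
    by (simp add: attractor_def)
  moreover have "compact attractor"
    using bounded_subset[OF bounded_closed_interval attractor_subset]
    by (simp add: compact_eq_bounded_closed attractor_def)
  moreover have "x islimpt attractor" if "x \<in> attractor" for x
    using attractor_islimpt[OF that] closure_subset unfolding attractor_def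
    by (rule islimpt_subset)
  moreover have "interior (closure attractor) = {}"
    using interior_attractor by (simp add: attractor_def)
  ultimately show ?thesis
    by (simp add: cantor_set_def)
qed

section \<open>Limit sets, sensitivity and frequencies\<close>

text \<open>
  An orbit is asymptotic to a sequence of values of \<Phi>, so it accumulates only on the attractor.
  Conversely the phases enter every interval directly to the right of s infinitely often, and right
  continuity then brings the orbit close to \<Phi> s.
\<close>

theorem omega_limit_set_orbit: "omega_limit_set (\<lambda>n. (step ^^ n) y) = attractor"
proof -
  let ?S = "\<lambda>n. (step ^^ n) y"
  obtain t N where trap: "\<And>n. N \<le> n \<Longrightarrow> trapped (?S n) (frac (t + real n * \<alpha>))"
    and shadow: "(\<lambda>n. \<Phi> (frac (t + real n * \<alpha>)) - ?S n) \<longlonglongrightarrow> 0"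
    using orbit_shadows_rotation by blast
  show ?thesis
  proof (intro subset_antisym subsetI)
    fix p assume "p \<in> omega_limit_set ?S"
    then obtain r where r: "strict_mono r" "(\<lambda>k. ?S (r k)) \<longlonglongrightarrow> p"
      by (auto simp: omega_limit_set_def)
    have "(\<lambda>k. \<Phi> (frac (t + real (r k) * \<alpha>)) - ?S (r k) + ?S (r k)) \<longlonglongrightarrow> 0 + p"
      using LIMSEQ_subseq_LIMSEQ[OF shadow r(1)] r(2) by (intro tendsto_add) (simp_all add: o_def)
    then have lim: "(\<lambda>k. \<Phi> (frac (t + real (r k) * \<alpha>))) \<longlonglongrightarrow> p"
      by simp
    have "\<Phi> (frac x) \<in> \<Phi> ` {0..<1}" for x :: real
      using frac_lt_1 by (intro imageI) simp
    then show "p \<in> attractor"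
      unfolding attractor_def closure_sequential
      using lim by (intro exI[of _ "\<lambda>k. \<Phi> (frac (t + real (r k) * \<alpha>))"]) simp
  next
    fix p assume p: "p \<in> attractor"
    have close: "\<exists>n>M. \<bar>?S n - p\<bar> < \<epsilon>" if "0 < \<epsilon>" for M \<epsilon>
    proof -
      obtain s where s: "0 \<le> s" "s < 1" "\<bar>\<Phi> s - p\<bar> < \<epsilon> / 2"
      proof -
        have "\<exists>x\<in>\<Phi> ` {0..<1}. dist x p < \<epsilon> / 2"
          using p \<open>0 < \<epsilon>\<close> unfolding attractor_def closure_approachable by (metis half_gt_zero)
        then show thesis
          using that by (auto simp: dist_real_def)
      qed
      obtain b where b: "s < b" "b \<le> 1" "\<And>s'. s < s' \<Longrightarrow> s' < b \<Longrightarrow> \<Phi> s' < \<Phi> s + \<epsilon> / 2"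
        using \<Phi>_right_near[OF s(2), of "\<epsilon> / 2"] \<open>0 < \<epsilon>\<close> by auto
      obtain n where n: "max M N < n" "frac (t + real n * \<alpha>) \<in> {s<..<b}"
        using irrational_rotation_infinitely_often[OF irrational s(1) b(1,2)]
        unfolding infinite_nat_iff_unbounded by blast
      then have "\<Phi> s \<le> ?S n" "?S n \<le> \<Phi> (frac (t + real n * \<alpha>))"
        using trap[of n] s(1) by (auto simp: trapped_def)
      moreover have "\<Phi> (frac (t + real n * \<alpha>)) < \<Phi> s + \<epsilon> / 2"
        using n(2) by (intro b(3)) auto
      ultimately have "\<bar>?S n - p\<bar> < \<epsilon>"
        using s(3) by linarith
      then show ?thesis
        using n(1) by (intro exI[of _ n]) simp
    qed
    have "\<exists>r. \<forall>k. \<bar>?S (r k) - p\<bar> < 1 / real (Suc k) \<and> r k < r (Suc k)"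
    proof (rule dependent_nat_choice)
      show "\<exists>n. \<bar>?S n - p\<bar> < 1 / real (Suc 0)"
        using close[of "1 / real (Suc 0)" 0] by auto
      show "\<exists>n. \<bar>?S n - p\<bar> < 1 / real (Suc (Suc k)) \<and> m < n" for m k
        using close[of "1 / real (Suc (Suc k))" m] by auto
    qed
    then obtain r where r: "\<And>k. \<bar>?S (r k) - p\<bar> < 1 / real (Suc k)" "\<And>k. r k < r (Suc k)"
      by blast
    have "(\<lambda>k. ?S (r k) - p) \<longlonglongrightarrow> 0"
    proof (rule Lim_null_comparison)
      show "\<forall>\<^sub>F k in sequentially. norm (?S (r k) - p) \<le> 1 / real (Suc k)"
        using r(1) by (intro always_eventually allI) (simp add: less_imp_le)
      show "(\<lambda>k. 1 / real (Suc k)) \<longlonglongrightarrow> 0"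
        by (rule lim_inverse_n'[THEN LIMSEQ_Suc])
    qed
    then have "(\<lambda>k. ?S (r k)) \<longlonglongrightarrow> p"
      by (simp add: LIM_zero_iff)
    then show "p \<in> omega_limit_set ?S"
      using r(2) by (auto simp: omega_limit_set_def strict_mono_Suc_iff)
  qed
qed

text \<open>
  The difference of the phases is constant in time. At some time an integer lies between them on the
  line; then one phase is just below 1 and the other just above 0, and the orbits are on opposite
  sides of the interval from \<Phi> (1/4) to \<Phi> (3/4).
\<close>

lemma orbits_separate:
  assumes "trapped y t" "trapped y' t'" "t < t'" "t' < t + 1 / 4"
  shows "\<exists>k. \<Phi> (3 / 4) - \<Phi> (1 / 4) \<le> (step ^^ k) y - (step ^^ k) y'"
proof -
  obtain n where n: "0 < n" "frac (t' + real n * \<alpha>) \<in> {0<..<t' - t}"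
    using irrational_rotation_infinitely_often[OF irrational, of 0 "t' - t" t'] assms(3,4)
    unfolding infinite_nat_iff_unbounded by auto
  have "frac (t + real n * \<alpha>) = frac (t' + real n * \<alpha>) - (t' - t) + 1"
    unfolding frac_unique_iff
  proof (intro conjI)
    show "t + real n * \<alpha> - (frac (t' + real n * \<alpha>) - (t' - t) + 1) \<in> \<int>"
      by (simp add: frac_def)
  qed (use n assms(4) in \<open>auto simp del: frac_gt_0_iff\<close>)
  then have "3 / 4 < frac (t + real n * \<alpha>)" "frac (t' + real n * \<alpha>) < 1 / 4"
    using n assms(4) by (auto simp del: frac_gt_0_iff)
  moreover have "trapped ((step ^^ n) y) (frac (t + real n * \<alpha>))"
    "trapped ((step ^^ n) y') (frac (t' + real n * \<alpha>))"
    using trapped_orbit(1)[OF assms(1), of "n - 1"] trapped_orbit(1)[OF assms(2), of "n - 1"] n(1)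
    by simp_all
  ultimately have "\<Phi> (3 / 4) \<le> (step ^^ n) y" "(step ^^ n) y' \<le> \<Phi> (1 / 4)"
    using \<Phi>_mono[of "frac (t' + real n * \<alpha>)" "1 / 4"] by (auto simp: trapped_def)
  then show ?thesis
    by (intro exI[of _ n]) simp
qed

text \<open>
  Near a point y of the attractor there are values of \<Phi> at phases different from that of y. By
  monotonicity such a phase can be moved towards the phase of y without increasing the distance to y,
  until the two phases are close enough for the orbits to separate. The separation constant depends
  neither on y nor on the distance.
\<close>

theorem sensitive_on_attractor:
  assumes "y \<in> attractor" "0 < \<epsilon>"
  shows "\<exists>y' k. 0 \<le> y' \<and> \<bar>y' - y\<bar> \<le> \<epsilon> \<and> \<Phi> (3 / 4) - \<Phi> (1 / 4) \<le> \<bar>(step ^^ k) y' - (step ^^ k) y\<bar>"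
proof -
  obtain t where t: "trapped y t"
  proof -
    have "0 \<le> y" "y \<le> 1"
      using assms(1) attractor_subset by auto
    then show thesis
      using trapped_exists that by blast
  qed
  have y_le: "y \<le> \<Phi> t" and le_y: "\<And>s. 0 \<le> s \<Longrightarrow> s < t \<Longrightarrow> \<Phi> s \<le> y" and t01: "0 \<le> t" "t \<le> 1"
    using t by (auto simp: trapped_def)
  have approach: "\<exists>x\<in>\<Phi> ` {0..<1}. x \<noteq> y \<and> \<bar>x - y\<bar> < e" if "0 < e" for e
    using attractor_islimpt[OF assms(1)] that unfolding islimpt_approachable dist_real_def by blast
  have "\<exists>x\<in>\<Phi> ` {0..<1}. x \<noteq> \<Phi> t \<and> \<bar>x - y\<bar> < \<epsilon>"
  proof (cases "y = \<Phi> t")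
    case True
    then show ?thesis
      using approach[OF assms(2)] by blast
  next
    case False
    then show ?thesis
      using approach[of "min \<epsilon> (\<Phi> t - y)"] assms(2) y_le by force
  qed
  then obtain t1 where t1: "0 \<le> t1" "t1 < 1" "t1 \<noteq> t" "\<bar>\<Phi> t1 - y\<bar> < \<epsilon>"
    by fastforce
  show ?thesis
  proof (cases "t1 < t")
    case True
    \<comment> \<open>1/8 keeps the phases within the distance 1/4 that the separation of orbits requires\<close>
    define t2 where "t2 = max t1 (t - 1 / 8)"
    have t2: "0 \<le> t2" "t1 \<le> t2" "t2 < t" "t < t2 + 1 / 4"
      using t1 True by (auto simp: t2_def)
    obtain k where "\<Phi> (3 / 4) - \<Phi> (1 / 4) \<le> (step ^^ k) (\<Phi> t2) - (step ^^ k) y"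
      using orbits_separate[OF trapped_\<Phi>[of t2] t] t2 t01 by auto
    moreover have "\<Phi> t1 \<le> \<Phi> t2" "\<Phi> t2 \<le> y"
      using t2 \<Phi>_mono le_y by auto
    ultimately show ?thesis
      using t1(4) t2(1) \<Phi>_mono[of 0 t2] \<Phi>_0 by (intro exI[of _ "\<Phi> t2"] exI[of _ k]) auto
  next
    case False
    define t2 where "t2 = min t1 (t + 1 / 8)"
    have t2: "0 \<le> t2" "t2 \<le> t1" "t < t2" "t2 < t + 1 / 4"
      using t1 False t01 by (auto simp: t2_def)
    obtain k where "\<Phi> (3 / 4) - \<Phi> (1 / 4) \<le> (step ^^ k) y - (step ^^ k) (\<Phi> t2)"
      using orbits_separate[OF t trapped_\<Phi>[of t2]] t2 t1 by auto
    moreover have "\<Phi> t2 \<le> \<Phi> t1" "\<Phi> t \<le> \<Phi> t2"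
      using t2 \<Phi>_mono by auto
    ultimately show ?thesis
      using t1(4) t2(1) y_le \<Phi>_mono[of 0 t2] \<Phi>_0 by (intro exI[of _ "\<Phi> t2"] exI[of _ k]) auto
  qed
qed

text \<open>
  By monotonicity the phases s with \<Phi> s in J form an interval K. Whenever the phase of an orbit point
  is interior to K the point is in J, and whenever it is outside the closure of K the point is not in J.
  The end points of K are phases at one time at most, so the frequency of J is the length of K. If K
  is empty, two visits of J with different phases would enclose a value of \<Phi> in J; all visits then
  have the same phase, and there is at most one.
\<close>

theorem orbit_frequency:
  assumes "is_interval J"
  shows "\<exists>c. \<forall>y. has_frequency (\<lambda>n. (step ^^ n) y \<in> J) c"
proof -
  have J: "\<And>x y z. x \<in> J \<Longrightarrow> z \<in> J \<Longrightarrow> x \<le> y \<Longrightarrow> y \<le> z \<Longrightarrow> y \<in> J"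
    using assms unfolding is_interval_1 by blast
  define K where "K = {s. 0 \<le> s \<and> s < 1 \<and> \<Phi> s \<in> J}"
  have between: "y \<in> J" if "trapped y u" "0 \<le> s" "s < u" "u \<le> s'" "\<Phi> s \<in> J" "\<Phi> s' \<in> J" for y s u s'
    using J[OF that(5,6)] that \<Phi>_mono[of u s'] by (auto simp: trapped_def)
  have "\<exists>a b. 0 \<le> a \<and> a \<le> b \<and> b \<le> 1 \<and> (\<forall>(Y :: nat \<Rightarrow> real) t N.
      (\<forall>n\<ge>N. trapped (Y n) (frac (t + real n * \<alpha>))) \<longrightarrow>
      finite {n. (frac (t + real n * \<alpha>) \<in> {a..<b}) \<noteq> (Y n \<in> J)})"
  proof (cases "K = {}")
    case True
    have unique: "\<not> u < u'" if "trapped y u" "trapped y' u'" "y \<in> J" "y' \<in> J" "u' < 1" for y u y' u'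
    proof
      assume "u < u'"
      let ?s = "(u + u') / 2"
      have "y \<le> \<Phi> ?s" "\<Phi> ?s \<le> y'"
        using that \<open>u < u'\<close> \<Phi>_mono[of u ?s] by (auto simp: trapped_def)
      then have "?s \<in> K"
        using that \<open>u < u'\<close> J[of y y' "\<Phi> ?s"] by (auto simp: K_def trapped_def)
      with True show False
        by blast
    qed
    have "finite {n. Y n \<in> J}" if trap: "\<forall>n\<ge>N. trapped (Y n) (frac (t + real n * \<alpha>))"
      for Y :: "nat \<Rightarrow> real" and t N
    proof (cases "\<exists>n\<ge>N. Y n \<in> J")
      case True
      then obtain m where m: "N \<le> m" "Y m \<in> J"
        by blast
      have "frac (t + real n * \<alpha>) = frac (t + real m * \<alpha>)" if "N \<le> n" "Y n \<in> J" for n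
      proof (rule linorder_cases)
        assume "frac (t + real n * \<alpha>) < frac (t + real m * \<alpha>)"
        then show ?thesis
          using unique[of "Y n" _ "Y m"] trap m that frac_lt_1 by blast
      next
        assume "frac (t + real m * \<alpha>) < frac (t + real n * \<alpha>)"
        then show ?thesis
          using unique[of "Y m" _ "Y n"] trap m that frac_lt_1 by blast
      qed
      then have "{n. Y n \<in> J} \<subseteq> {..<N} \<union> {n. frac (t + real n * \<alpha>) = frac (t + real m * \<alpha>)}"
        using not_less by blast
      then show ?thesis
        by (rule finite_subset) (simp add: irrational_rotation_finitely_often[OF irrational])
    next
      case False
      then have "{n. Y n \<in> J} \<subseteq> {..<N}"
        by (auto simp: not_le[symmetric])
      then show ?thesis
        by (rule finite_subset) simp
    qed
    then show ?thesis
      by (intro exI[of _ 0]) simp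
  next
    case False
    have bdd: "bdd_below K" "bdd_above K"
      by (auto simp: K_def intro: bdd_belowI[of _ 0] bdd_aboveI[of _ 1])
    have inside: "y \<in> J" if "trapped y u" "Inf K < u" "u < Sup K" for y u
    proof -
      obtain s where "s \<in> K" "s < u"
        using cInf_lessD[OF False \<open>Inf K < u\<close>] by blast
      moreover obtain s' where "s' \<in> K" "u < s'"
        using less_cSupD[OF False \<open>u < Sup K\<close>] by blast
      ultimately show ?thesis
        using between[OF that(1), of s s'] by (simp add: K_def)
    qed
    have outside: "Inf K \<le> u \<and> u \<le> Sup K" if "trapped y u" "u < 1" "y \<in> J" for y u
    proof -
      obtain s where s: "s \<in> K"
        using False by blast
      have u: "0 \<le> u" "y \<le> \<Phi> u" "\<And>s. 0 \<le> s \<Longrightarrow> s < u \<Longrightarrow> \<Phi> s \<le> y"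
        using that(1) by (auto simp: trapped_def)
      have "Inf K \<le> u"
      proof (rule ccontr)
        assume "\<not> Inf K \<le> u"
        then have "u \<le> s"
          using cInf_lower[OF s bdd(1)] by simp
        then have "u \<in> K"
          using J[of y "\<Phi> s" "\<Phi> u"] u that s \<Phi>_mono by (simp add: K_def)
        then show False
          using cInf_lower[OF _ bdd(1)] \<open>\<not> Inf K \<le> u\<close> by blast
      qed
      moreover have "u \<le> Sup K"
      proof (rule ccontr)
        assume "\<not> u \<le> Sup K"
        define s' where "s' = (Sup K + u) / 2"
        have s': "Sup K < s'" "s' < u" "s \<le> s'" "0 \<le> s'"
          using cSup_upper[OF s bdd(2)] \<open>\<not> u \<le> Sup K\<close> s by (auto simp: s'_def K_def)
        then have "s' \<in> K"
          using J[of "\<Phi> s" y "\<Phi> s'"] u(3)[of s'] that s \<Phi>_mono by (simp add: K_def)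
        then show False
          using cSup_upper[OF _ bdd(2)] s'(1) by fastforce
      qed
      ultimately show ?thesis ..
    qed
    have "finite {n. (frac (t + real n * \<alpha>) \<in> {Inf K..<Sup K}) \<noteq> (Y n \<in> J)}"
      if trap: "\<forall>n\<ge>N. trapped (Y n) (frac (t + real n * \<alpha>))" for Y :: "nat \<Rightarrow> real" and t N
    proof -
      let ?x = "\<lambda>n. frac (t + real n * \<alpha>)"
      have "n \<in> {..<N} \<union> {n. ?x n = Inf K} \<union> {n. ?x n = Sup K}"
        if "(?x n \<in> {Inf K..<Sup K}) \<noteq> (Y n \<in> J)" for n
      proof (cases "n < N")
        case False
        then have "trapped (Y n) (?x n)"
          using trap by simp
        then show ?thesis
          using inside outside[OF _ frac_lt_1] that by fastforce
      qed simp
      then have "{n. (?x n \<in> {Inf K..<Sup K}) \<noteq> (Y n \<in> J)} \<subseteq> {..<N} \<union> {n. ?x n = Inf K} \<union> {n. ?x n = Sup K}"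
        by blast
      then show ?thesis
        by (rule finite_subset) (simp add: irrational_rotation_finitely_often[OF irrational])
    qed
    moreover have "0 \<le> Inf K" "Sup K \<le> 1"
      using False by (auto simp: K_def intro: cInf_greatest cSup_least)
    moreover have "Inf K \<le> Sup K"
      using False bdd by (intro cInf_le_cSup)
    ultimately show ?thesis
      by blast
  qed
  then obtain a b where ab: "0 \<le> a" "a \<le> b" "b \<le> 1"
    and exceptions: "\<And>(Y :: nat \<Rightarrow> real) t N. \<forall>n\<ge>N. trapped (Y n) (frac (t + real n * \<alpha>)) \<Longrightarrow>
      finite {n. (frac (t + real n * \<alpha>) \<in> {a..<b}) \<noteq> (Y n \<in> J)}"
    by blast
  have "has_frequency (\<lambda>n. (step ^^ n) y \<in> J) (b - a)" for y
  proof -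
    obtain t N where "\<And>n. N \<le> n \<Longrightarrow> trapped ((step ^^ n) y) (frac (t + real n * \<alpha>))"
      using orbit_shadows_rotation by blast
    then have "finite {n. (frac (t + real n * \<alpha>) \<in> {a..<b}) \<noteq> ((step ^^ n) y \<in> J)}"
      by (intro exceptions[of N "\<lambda>n. (step ^^ n) y" t]) simp
    then show ?thesis
      by (rule has_frequency_finite_change[OF irrational_rotation_equidistributed[OF irrational ab]])
  qed
  then show ?thesis
    by blast
qed

text \<open>
  The atom at \<alpha> contributes 1, and the other atoms between 0 and \<alpha> are marked by the letters 1 of the
  Sturmian word of slope \<alpha>.
\<close>

lemma \<Phi>_\<alpha>_eq:
  "\<Phi> \<alpha> = (1 - q) * (1 + q * (\<Sum>k. of_int (\<lfloor>- real (k + 1) * \<alpha>\<rfloor> - \<lfloor>- real (k + 2) * \<alpha>\<rfloor>) * q ^ k))"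
proof -
  have first: "crossings 0 \<alpha> 0 = 1"
  proof -
    have "\<lfloor>- \<alpha>\<rfloor> = -1"
      using \<alpha>_pos \<alpha>_less_1 by (intro floor_unique) auto
    then show ?thesis
      by (simp add: crossings_def)
  qed
  have rest: "crossings 0 \<alpha> (Suc k) = \<lfloor>- real (k + 1) * \<alpha>\<rfloor> - \<lfloor>- real (k + 2) * \<alpha>\<rfloor>" for k
    by (simp add: crossings_def algebra_simps)
  have "(\<Sum>k. q ^ k * of_int (crossings 0 \<alpha> k)) = 1 + (\<Sum>k. q ^ Suc k * of_int (crossings 0 \<alpha> (Suc k)))"
    using suminf_split_head[OF summable_crossings[of 0 \<alpha>]] first by simp
  also have "(\<Sum>k. q ^ Suc k * of_int (crossings 0 \<alpha> (Suc k)))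
     = q * (\<Sum>k. of_int (crossings 0 \<alpha> (Suc k)) * q ^ k)"
  proof -
    have "summable (\<lambda>k. of_int (crossings 0 \<alpha> (Suc k)) * q ^ k)"
      unfolding rest mult.commute[of _ "q ^ _"]
      using summable_crossings[of "- \<alpha>" 0] by (simp add: crossings_def algebra_simps)
    then show ?thesis
      by (subst suminf_mult[symmetric]) (simp_all add: mult_ac)
  qed
  finally show ?thesis
    by (simp add: \<Phi>_def rest)
qed


section \<open>Transfer to the financial process\<close>

lemma affine_image_islimpt:
  fixes x :: real
  assumes "x islimpt S" "B \<noteq> 0"
  shows "A + B * x islimpt (\<lambda>y. A + B * y) ` S"
  unfolding islimpt_approachable
proof (intro allI impI)
  fix e :: real assume "0 < e"
  then obtain z where "z \<in> S" "z \<noteq> x" "dist z x < e / \<bar>B\<bar>"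
    using assms unfolding islimpt_approachable by (meson divide_pos_pos zero_less_abs_iff)
  moreover have "dist (A + B * z) (A + B * x) = \<bar>B\<bar> * dist z x"
    by (simp add: dist_real_def flip: abs_mult right_diff_distrib)
  ultimately show "\<exists>x'\<in>(\<lambda>y. A + B * y) ` S. x' \<noteq> A + B * x \<and> dist x' (A + B * x) < e"
    using assms(2) by (intro bexI[of _ "A + B * z"]) (simp_all add: pos_less_divide_eq mult.commute)
qed

lemma cantor_set_affine_image:
  assumes "cantor_set C" "B \<noteq> 0"
  shows "cantor_set ((\<lambda>y. A + B * y) ` C)"
proof -
  have C: "C \<noteq> {}" "compact C" "\<And>x. x \<in> C \<Longrightarrow> x islimpt C" "interior C = {}"
    using assms(1) by (auto simp: cantor_set_def compact_imp_closed closure_closed)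
  let ?f = "\<lambda>y. A + B * y"
  have comp: "compact (?f ` C)"
    using C(2) by (intro compact_continuous_image continuous_intros)
  have "?f -` interior (?f ` C) \<subseteq> interior C"
  proof (rule interior_maximal)
    show "?f -` interior (?f ` C) \<subseteq> C"
      using assms(2) interior_subset[of "?f ` C"] by fastforce
    show "open (?f -` interior (?f ` C))"
      by (intro open_vimage open_interior continuous_intros)
  qed
  moreover have "p \<in> ?f ` (?f -` {p})" for p
    using assms(2) by (auto intro!: image_eqI[of _ _ "(p - A) / B"])
  ultimately have "interior (?f ` C) = {}"
    using C(4) by fastforce
  then show ?thesis
    using C(1) comp compact_imp_closed[OF comp] affine_image_islimpt[OF C(3) assms(2)]
    by (auto simp: cantor_set_def)
qed

lemma omega_limit_set_affine_image:
  assumes "B \<noteq> 0"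
  shows "omega_limit_set (\<lambda>n. A + B * S n) = (\<lambda>y. A + B * y) ` omega_limit_set S"
proof (intro subset_antisym subsetI)
  fix p assume "p \<in> omega_limit_set (\<lambda>n. A + B * S n)"
  then obtain r where r: "strict_mono r" "(\<lambda>k. A + B * S (r k)) \<longlonglongrightarrow> p"
    by (auto simp: omega_limit_set_def)
  have "(\<lambda>k. (A + B * S (r k) - A) / B) \<longlonglongrightarrow> (p - A) / B"
    using assms r(2) by (intro tendsto_intros)
  then have "(p - A) / B \<in> omega_limit_set S"
    using r(1) assms by (auto simp: omega_limit_set_def)
  then show "p \<in> (\<lambda>y. A + B * y) ` omega_limit_set S"
    using assms by (auto intro!: image_eqI[of _ _ "(p - A) / B"])
next
  fix p assume "p \<in> (\<lambda>y. A + B * y) ` omega_limit_set S"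
  then show "p \<in> omega_limit_set (\<lambda>n. A + B * S n)"
    by (auto simp: omega_limit_set_def intro!: tendsto_intros)
qed

text \<open>
  The factor B multiplies distances, hence the separation constant, and the preimage of an interval
  under the affine map is an interval; all other notions are carried over unchanged.
\<close>

theorem chaotic_if_conjugate:
  assumes conj: "\<And>y. financial_map v1 v2 r \<rho> (A + B * y) = A + B * step y"
    and "0 \<le> A" "0 < B"
  shows "chaotic_financial_process v1 v2 r \<rho>"
proof -
  let ?f = "\<lambda>y. A + B * y"
  let ?C = "?f ` attractor"
  have "B \<noteq> 0"
    using assms(3) by simp
  have series: "financial_series v1 v2 r \<rho> (?f y) n = ?f ((step ^^ n) y)" for y n
    by (induction n) (simp_all add: conj)
  have coord: "\<exists>y. S\<^sub>0 = ?f y" for S\<^sub>0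
    using \<open>B \<noteq> 0\<close> by (intro exI[of _ "(S\<^sub>0 - A) / B"]) simp
  have "?C \<subseteq> {0..}"
    using attractor_subset assms(2,3) by (auto intro!: add_nonneg_nonneg mult_nonneg_nonneg)
  moreover have "omega_limit_set (financial_series v1 v2 r \<rho> S\<^sub>0) = ?C" for S\<^sub>0
  proof -
    obtain y where "S\<^sub>0 = ?f y"
      using coord by blast
    then show ?thesis
      using omega_limit_set_affine_image[OF \<open>B \<noteq> 0\<close>, of A "\<lambda>n. (step ^^ n) y"]
      by (simp add: series[abs_def] omega_limit_set_orbit)
  qed
  moreover have "sensitive_dependence_at v1 v2 r \<rho> S\<^sub>0" if S\<^sub>0: "S\<^sub>0 \<in> ?C" for S\<^sub>0
    unfolding sensitive_dependence_at_def
  proof (rule exI[of _ "B * (\<Phi> (3 / 4) - \<Phi> (1 / 4))"], intro conjI allI impI)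
    show "0 < B * (\<Phi> (3 / 4) - \<Phi> (1 / 4))"
      using assms(3) \<Phi>_strict_mono[of "1 / 4" "3 / 4"] by simp
    fix \<epsilon> :: real assume "0 < \<epsilon>"
    obtain y where y: "y \<in> attractor" "S\<^sub>0 = ?f y"
      using S\<^sub>0 by blast
    obtain y' k where y': "0 \<le> y'" "\<bar>y' - y\<bar> \<le> \<epsilon> / B"
      "\<Phi> (3 / 4) - \<Phi> (1 / 4) \<le> \<bar>(step ^^ k) y' - (step ^^ k) y\<bar>"
      using sensitive_on_attractor[OF y(1), of "\<epsilon> / B"] \<open>0 < \<epsilon>\<close> assms(3) by auto
    have scale: "\<bar>?f u - ?f v\<bar> = B * \<bar>u - v\<bar>" for u v
      using assms(3) by (simp add: abs_mult flip: right_diff_distrib)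
    have "\<bar>?f y' - S\<^sub>0\<bar> \<le> \<epsilon>"
      unfolding y(2) scale using y'(2) assms(3) by (simp add: field_simps)
    moreover have "B * (\<Phi> (3 / 4) - \<Phi> (1 / 4))
        \<le> \<bar>financial_series v1 v2 r \<rho> (?f y') k - financial_series v1 v2 r \<rho> S\<^sub>0 k\<bar>"
      unfolding y(2) series scale using y'(3) assms(3) by simp
    moreover have "0 \<le> ?f y'"
      using y'(1) assms(2,3) by simp
    ultimately show "\<exists>S\<^sub>0'\<ge>0. \<exists>k. \<bar>S\<^sub>0' - S\<^sub>0\<bar> \<le> \<epsilon> \<and> B * (\<Phi> (3 / 4) - \<Phi> (1 / 4))
        \<le> \<bar>financial_series v1 v2 r \<rho> S\<^sub>0' k - financial_series v1 v2 r \<rho> S\<^sub>0 k\<bar>"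
      by blast
  qed
  moreover have "\<exists>c\<ge>0. \<forall>S\<^sub>0\<ge>0.
      (\<lambda>N. 1 / real N * real (card {n. n < N \<and> financial_series v1 v2 r \<rho> S\<^sub>0 n \<in> J})) \<longlonglongrightarrow> c"
    if "is_interval J" for J
  proof -
    have "is_interval (?f -` J)"
      unfolding is_interval_1
    proof (intro ballI allI impI)
      fix x y z assume "x \<in> ?f -` J" "y \<in> ?f -` J" "x \<le> z \<and> z \<le> y"
      then show "z \<in> ?f -` J"
        using that assms(3) mem_is_interval_1_I[of J "?f x" "?f y" "?f z"] by simp
    qed
    then obtain c where c: "\<And>y. has_frequency (\<lambda>n. (step ^^ n) y \<in> ?f -` J) c"
      using orbit_frequency by blast
    have "has_frequency (\<lambda>n. financial_series v1 v2 r \<rho> S\<^sub>0 n \<in> J) c" for S\<^sub>0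
      using coord[of S\<^sub>0] c by (auto simp: series)
    then show ?thesis
      using has_frequency_nonneg[OF c] unfolding has_frequency_def by blast
  qed
  ultimately show ?thesis
    using cantor_set_affine_image[OF cantor_set_attractor \<open>B \<noteq> 0\<close>, of A]
    unfolding chaotic_financial_process_def by (intro exI[of _ ?C]) auto
qed

end

text \<open>
  The Fibonacci word is the Sturmian word of slope 2 minus the golden ratio; the minus signs turn the
  defining floors of multiples of the golden ratio into the shape of the series for the offset.
\<close>

lemma fibonacci_word_eq_floor_diff:
  "fibonacci_word k = \<lfloor>- real (k + 1) * (2 - golden_ratio)\<rfloor> - \<lfloor>- real (k + 2) * (2 - golden_ratio)\<rfloor>"
proof -
  have "\<lfloor>- real j * (2 - golden_ratio)\<rfloor> = \<lfloor>real j * golden_ratio\<rfloor> - 2 * int j" for j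
  proof -
    have "- real j * (2 - golden_ratio) = real j * golden_ratio - of_int (2 * int j)"
      by (simp add: algebra_simps)
    then show ?thesis
      by (simp only: floor_diff_of_int)
  qed
  from this[of "k + 1"] this[of "k + 2"] show ?thesis
    by (simp add: fibonacci_word_def algebra_simps)
qed

theorem theorem2:
  fixes b \<delta> r \<rho> :: real
  assumes "1 < b"
    and "\<delta> = 1 - 1 / b + 1 / b * (1 - 1 / b) * (\<Sum>k. real_of_int (fibonacci_word k) / b ^ k)"
    and "r = 1 / b - 1"
    and "\<rho> = 500 * b / (b - 1) * (b * (1 - \<delta>) + 1)"
  shows "admissible_parameters 1000 500 r \<rho> \<and> chaotic_financial_process 1000 500 r \<rho>"
proof
  have sqrt5: "2 < sqrt 5" "sqrt 5 < 3"
    by (simp_all add: real_less_rsqrt real_less_lsqrt)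
  interpret contracted_rotation "1 / b" "2 - golden_ratio"
  proof
    show "2 - golden_ratio \<notin> \<rat>"
    proof
      assume "2 - golden_ratio \<in> \<rat>"
      then have "2 - (2 - golden_ratio) \<in> \<rat>"
        by (rule Rats_diff[OF Rats_number_of])
      then have "2 * golden_ratio - 1 \<in> \<rat>"
        by (intro Rats_diff Rats_mult) simp_all
      also have "2 * golden_ratio - 1 = sqrt 5"
        by (simp add: golden_ratio_def field_simps)
      finally show False
        using sqrt_5_irrational by simp
    qed
  qed (use assms(1) sqrt5 in \<open>auto simp: golden_ratio_def\<close>)
  have \<delta>: "\<Phi> (2 - golden_ratio) = \<delta>"
    unfolding \<Phi>_\<alpha>_eq assms(2)
    by (simp add: fibonacci_word_eq_floor_diff power_one_over divide_inverse power_inverse algebra_simps)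
  have \<delta>_bounds: "0 < \<delta>" "\<delta> < 1"
    using \<Phi>_\<alpha>_pos \<Phi>_\<alpha>_less_1 by (simp_all add: \<delta>)
  have \<theta>: "\<Phi> (1 - (2 - golden_ratio)) = b * (1 - \<delta>)"
    using threshold assms(1) by (simp add: \<delta> field_simps)
  show "admissible_parameters 1000 500 r \<rho>"
  proof -
    have "0 < b * (1 - \<delta>) + 1"
      using assms(1) \<delta>_bounds by (intro add_pos_pos mult_pos_pos) auto
    then have "0 < \<rho>"
      using assms(1) by (simp add: assms(4))
    then show ?thesis
      using assms(1,3) by (simp add: admissible_parameters_def)
  qed
  \<comment> \<open>the scale 500 is the difference of the added constants 1000 and 500; comparing the constant
    terms on the first branch gives the equation A = A / b + 1000 - 500\<delta>\<close>
  define A where "A = (1000 - 500 * \<delta>) * b / (b - 1)"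
  show "chaotic_financial_process 1000 500 r \<rho>"
  proof (rule chaotic_if_conjugate)
    show "0 \<le> A"
      using assms(1) \<delta>_bounds by (simp add: A_def)
    fix y
    have "\<rho> = A + 500 * (b * (1 - \<delta>))"
      using assms(1) unfolding A_def assms(4) by (simp add: field_simps)
    moreover have "A / b = A - 1000 + 500 * \<delta>"
      using assms(1) by (simp add: A_def field_simps)
    ultimately show "financial_map 1000 500 r \<rho> (A + 500 * y) = A + 500 * step y"
      by (simp add: financial_map_def step_def \<theta>[simplified] \<delta> assms(3) add_divide_distrib algebra_simps)
  qed simp
qed

end
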